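(* For all positive integers $n,m,r$, \[ A_{r+1}(n,m,1)=A_r(n,m,n). \]
   Context: $[n]=\{1,\dots,n\}$, and a permutation of $[n]$ is a bijection $\sigma:[n]\to[n]$. For a positive integer $r$, an $r$-descent of $\sigma$ is a position $i$ with $1\le i<n$ and $\sigma(i)\ge\sigma(i+1)+r$. $A_r(n,m,k)$ denotes the number of permutations $\sigma$ of $[n]$ with exactly $m$ $r$-descents and $\sigma(n)=k$ (so it is $0$ if no such permutation exists). *)

theory Defs
  imports "HOL-Combinatorics.Permutations"
begin

definition r_descents :: "nat \<Rightarrow> nat \<Rightarrow> (nat \<Rightarrow> nat) \<Rightarrow> nat set" where
  "r_descents r n \<sigma> = {i. 1 \<le> i \<and> i < n \<and> \<sigma> i \<ge> \<sigma> (i + 1) + r}"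

definition A :: "nat \<Rightarrow> nat \<Rightarrow> nat \<Rightarrow> nat \<Rightarrow> nat" where
  "A r n m k = card {\<sigma>. \<sigma> permutes {1..n} \<and> card (r_descents r n \<sigma>) = m \<and> \<sigma> n = k}"

end

theory Submission
  imports Defs
begin

text \<open>
  Let \<open>M i\<close> be the maximum of \<open>w 1, \<dots>, w i\<close>. Foata's transformation sends a word \<open>w\<close> to the
  permutation \<open>\<sigma>\<close> whose cycles are the blocks of \<open>w\<close> starting at the left-to-right maxima.
  Explicitly \<open>\<sigma> (w i) = min (M i) (w (i + 1))\<close>, that is, \<open>\<sigma>\<close> takes \<open>w\<close> to the result of one pass
  of bubble sort. It turns the \<open>r\<close>-descents of \<open>w\<close> into the drops \<open>\<sigma> x + r \<le> x\<close>, and \<open>w n = k\<close> into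
  \<open>\<sigma> k = n\<close>. Finally, precomposition with the cycle \<open>i \<mapsto> i + 1\<close> takes the permutations with
  \<open>\<sigma> 1 = n\<close> to those with \<open>\<sigma> n = n\<close> and lowers the threshold of the drops from \<open>r + 1\<close> to \<open>r\<close>.
\<close>

definition prefix_max :: "(nat \<Rightarrow> nat) \<Rightarrow> nat \<Rightarrow> nat" where
  "prefix_max w i = Max (w ` {1..i})"

text \<open>At \<open>i = n\<close> the value \<open>w (n + 1) = n + 1\<close> plays the role of infinity.\<close>
definition bubble :: "nat \<Rightarrow> (nat \<Rightarrow> nat) \<Rightarrow> nat \<Rightarrow> nat" where
  "bubble n w i = (if i \<in> {1..n} then min (prefix_max w i) (w (i + 1)) else i)"

definition foata :: "nat \<Rightarrow> (nat \<Rightarrow> nat) \<Rightarrow> nat \<Rightarrow> nat" where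
  "foata n w = bubble n w \<circ> inv w"

definition drops :: "nat \<Rightarrow> nat \<Rightarrow> (nat \<Rightarrow> nat) \<Rightarrow> nat set" where
  "drops r n \<sigma> = {x \<in> {1..n}. \<sigma> x + r \<le> x}"

text \<open>An injective self-map of a finite set is bijective. For both \<open>foata\<close> and
  the rotation, injectivity is thus enough to transport the count.\<close>

lemma card_Collect_comp:
  assumes "finite P" "inj_on f P" "f ` P \<subseteq> P"
  shows "card {x \<in> P. R (f x)} = card {y \<in> P. R y}"
proof -
  have "f ` P = P" by (rule endo_inj_surj[OF assms(1,3,2)])
  then have "{y \<in> P. R y} = f ` {x \<in> P. R (f x)}"
    using Compr_image_eq[of f P R] by simp
  moreover have "inj_on f {x \<in> P. R (f x)}"
    using assms(2) by (rule inj_on_subset) simp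
  ultimately show ?thesis by (simp add: card_image)
qed

lemma permutes_if_surj_on:
  assumes "finite S" "f ` S = S" "\<And>x. x \<notin> S \<Longrightarrow> f x = x"
  shows "f permutes S"
  using assms by (intro bij_imp_permutes) (auto simp: bij_betw_def eq_card_imp_inj_on)

lemma prefix_max_Suc:
  assumes "i \<ge> 1"
  shows "prefix_max w (Suc i) = max (prefix_max w i) (w (Suc i))"
proof -
  have "w ` {1..Suc i} = insert (w (Suc i)) (w ` {1..i})"
    using assms by (auto simp: atLeastAtMostSuc_conv)
  then show ?thesis using assms by (simp add: prefix_max_def max.commute)
qed

lemma prefix_max_ge: "1 \<le> i \<Longrightarrow> w i \<le> prefix_max w i"
  by (simp add: prefix_max_def)

lemma prefix_max_top:
  assumes "w permutes {1..n}" "n \<ge> 1"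
  shows "prefix_max w n = n"
  unfolding prefix_max_def permutes_image[OF assms(1)] using assms(2)
  by (intro Max_eqI) auto

lemma bubble_top:
  assumes "w permutes {1..n}" "n \<ge> 1"
  shows "bubble n w n = n"
proof -
  have "w (Suc n) = Suc n" using assms(1) by (simp add: permutes_not_in)
  then show ?thesis using assms by (simp add: bubble_def prefix_max_top)
qed

lemma insert_max_min: "insert (max a b) (insert (min a b) S) = insert a (insert b S)"
  for a b :: "'a::linorder"
  by (auto simp: min_def max_def)

text \<open>The pass carries the prefix maximum along. Each step deposits the smaller of the carried
  value and the next letter and carries the larger one on, so no value is lost.\<close>

lemma bubble_image_prefix:
  assumes "1 \<le> i" "i \<le> n"
  shows "insert (prefix_max w i) (bubble n w ` {1..<i}) = w ` {1..i}"
  using assms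
proof (induction i rule: nat_induct_at_least)
  case base
  then show ?case by (simp add: prefix_max_def)
next
  case (Suc i)
  have "{1..<Suc i} = insert i {1..<i}" using Suc.hyps by auto
  moreover have "bubble n w i = min (prefix_max w i) (w (Suc i))"
    using Suc.hyps Suc.prems by (simp add: bubble_def)
  ultimately have "insert (prefix_max w (Suc i)) (bubble n w ` {1..<Suc i})
      = insert (w (Suc i)) (insert (prefix_max w i) (bubble n w ` {1..<i}))"
    using Suc.hyps by (simp add: prefix_max_Suc insert_max_min insert_commute[of "w (Suc i)"])
  also have "\<dots> = w ` {1..Suc i}"
    using Suc by (simp add: atLeastAtMostSuc_conv)
  finally show ?case .
qed

lemma bubble_permutes:
  assumes "w permutes {1..n}" "n \<ge> 1"
  shows "bubble n w permutes {1..n}"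
proof (rule permutes_if_surj_on)
  \<comment> \<open>Both the bubble value at \<open>n\<close> and the final prefix maximum are
    \<open>n\<close>, so the whole image is the left side of \<open>bubble_image_prefix\<close> at
    \<open>i = n\<close>.\<close>
  have "{1..n} = insert n {1..<n}" using assms(2) by auto
  then have "bubble n w ` {1..n} = insert (prefix_max w n) (bubble n w ` {1..<n})"
    using assms by (simp add: bubble_top prefix_max_top)
  also have "\<dots> = {1..n}"
    using bubble_image_prefix[of n n w] assms by (simp add: permutes_image)
  finally show "bubble n w ` {1..n} = {1..n}" .
qed (auto simp: bubble_def)

lemma foata_permutes:
  assumes "w permutes {1..n}" "n \<ge> 1"
  shows "foata n w permutes {1..n}"
  unfolding foata_def
  by (intro permutes_compose permutes_inv bubble_permutes assms)

lemma foata_apply: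
  assumes "w permutes {1..n}"
  shows "foata n w (w i) = bubble n w i"
  using assms by (simp add: foata_def permutes_inverses)

lemma foata_top_iff:
  assumes "w permutes {1..n}" "n \<ge> 1"
  shows "foata n w k = n \<longleftrightarrow> w n = k"
proof -
  have "foata n w (w n) = n" using assms by (simp add: foata_apply bubble_top)
  moreover have "inj (foata n w)" using foata_permutes[OF assms] by (rule permutes_inj)
  ultimately show ?thesis by (metis injD)
qed

lemma permutes_prefix_image:
  fixes n :: nat
  assumes "w permutes {1..n}" "i \<le> n"
  shows "w ` {1..i} = {1..n} - w ` {Suc i..n}"
proof -
  have "{1..i} = {1..n} - {Suc i..n}" using assms(2) by auto
  then have "w ` {1..i} = w ` {1..n} - w ` {Suc i..n}"
    by (metis image_set_diff permutes_inj[OF assms(1)])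
  then show ?thesis using permutes_image[OF assms(1)] by simp
qed

text \<open>The word is recovered from right to left: the letters after position \<open>i\<close> determine the
  prefix maximum at \<open>i\<close>, hence the \<open>i\<close>-th value of the bubble pass and its preimage \<open>w i\<close>.\<close>
lemma foata_inj:
  assumes n: "n \<ge> 1"
  shows "inj_on (foata n) {w. w permutes {1..n}}"
proof (rule inj_onI, clarsimp)
  fix v w
  assume v: "v permutes {Suc 0..n}" and w: "w permutes {Suc 0..n}" and eq: "foata n v = foata n w"
  have perm: "v permutes {1..n}" "w permutes {1..n}" using v w by simp_all
  have agree: "v i = w i" if "1 \<le> i" for i
    using that
  proof (induction "Suc n - i" arbitrary: i rule: less_induct)
    case less
    show ?case
    proof (cases "i \<le> n")
      case False
      then show ?thesis using perm by (simp add: permutes_not_in)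
    next
      case True
      \<comment> \<open>As \<open>i \<le> n\<close>, the measure drops for every
        \<open>j > i\<close>. This includes \<open>j = n + 1\<close>, which enters the bubble value
        at \<open>i = n\<close>.\<close>
      have later: "v j = w j" if "i < j" for j
        using less that True by auto
      have "v ` {Suc i..n} = w ` {Suc i..n}"
        using later by (intro image_cong) auto
      then have "v ` {1..i} = w ` {1..i}"
        using perm True by (metis permutes_prefix_image)
      then have "bubble n v i = bubble n w i"
        using later[of "Suc i"] by (simp add: bubble_def prefix_max_def)
      then have "foata n w (v i) = foata n w (w i)"
        using perm by (metis eq foata_apply)
      then show ?thesis
        using permutes_inj[OF foata_permutes[OF perm(2) n]] by (simp add: inj_eq)
    qed
  qed
  show "v = w"
  proof
    show "v i = w i" for i
    proof (cases "i = 0")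
      case True
      then show ?thesis using perm by (simp add: permutes_not_in)
    qed (simp add: agree)
  qed
qed

text \<open>The prefix maximum is at least \<open>w i\<close>, so with \<open>r \<ge> 1\<close> only
  the other argument of the minimum can lie \<open>r\<close> below \<open>w i\<close>.\<close>

lemma bubble_drop_iff:
  assumes "1 \<le> i" "i \<le> n" "r \<ge> 1"
  shows "bubble n w i + r \<le> w i \<longleftrightarrow> w (i + 1) + r \<le> w i"
  using assms prefix_max_ge[of i w] by (auto simp: bubble_def min_def)

lemma drops_foata:
  assumes w: "w permutes {1..n}" and n: "n \<ge> 1" and r: "r \<ge> 1"
  shows "drops r n (foata n w) = w ` r_descents r n w"
proof -
  have "w ` {1..n} = {1..n}" using w by (rule permutes_image)
  then have "drops r n (foata n w) = w ` {i \<in> {1..n}. foata n w (w i) + r \<le> w i}"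
    using Compr_image_eq[of w "{1..n}" "\<lambda>x. foata n w x + r \<le> x"] by (simp add: drops_def)
  also have "{i \<in> {1..n}. foata n w (w i) + r \<le> w i} = r_descents r n w"
  proof -
    \<comment> \<open>Position \<open>n\<close> is never a descent. It gives no drop either, because
      the bubble value there is \<open>n\<close>.\<close>
    have "w n \<le> n" using permutes_in_image[OF w, of n] n by simp
    then have "\<not> bubble n w n + r \<le> w n" using r by (simp add: bubble_top[OF w n])
    then have "bubble n w i + r \<le> w i \<longleftrightarrow> i < n \<and> w (i + 1) + r \<le> w i" if "i \<in> {1..n}" for i
      using bubble_drop_iff[of i n r w] that r by (cases "i = n") auto
    then show ?thesis by (auto simp: r_descents_def foata_apply[OF w])
  qed
  finally show ?thesis .
qed

lemma A_eq_card_drops: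
  assumes n: "n \<ge> 1" and r: "r \<ge> 1"
  shows "A r n m k = card {\<sigma> \<in> {\<sigma>. \<sigma> permutes {1..n}}. card (drops r n \<sigma>) = m \<and> \<sigma> k = n}"
proof -
  have "card (drops r n (foata n w)) = card (r_descents r n w)" if "w permutes {1..n}" for w
    using that n r permutes_inj_on[OF that] by (simp add: drops_foata card_image)
  then have "A r n m k = card {w \<in> {w. w permutes {1..n}}.
      card (drops r n (foata n w)) = m \<and> foata n w k = n}"
    unfolding A_def using n
    by (intro arg_cong[where f = card] Collect_cong) (auto simp: foata_top_iff)
  also have "\<dots> = card {\<sigma> \<in> {\<sigma>. \<sigma> permutes {1..n}}. card (drops r n \<sigma>) = m \<and> \<sigma> k = n}"
    using n by (intro card_Collect_comp foata_inj finite_permutations) (auto simp: foata_permutes[simplified])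
  finally show ?thesis .
qed

definition rot :: "nat \<Rightarrow> nat \<Rightarrow> nat" where
  "rot n i = (if i = n then 1 else if i \<in> {1..<n} then i + 1 else i)"

lemma rot_permutes:
  assumes "n \<ge> 1"
  shows "rot n permutes {1..n}"
proof (rule permutes_if_surj_on)
  show "rot n ` {1..n} = {1..n}"
    using assms by (intro endo_inj_surj) (auto simp: rot_def inj_on_def split: if_splits)
qed (use assms in \<open>auto simp: rot_def\<close>)

text \<open>For \<open>x = Suc y\<close> with \<open>1 \<le> y < n\<close>, the value at
  \<open>x\<close> becomes the value at \<open>y\<close>, and cancelling 1 lowers the threshold. The
  leftover points, \<open>x = 1\<close> on the left and \<open>y = n\<close> on the right, both take
  the value \<open>n\<close> and are not drops.\<close>

lemma drops_rot:
  assumes \<sigma>: "\<sigma> 1 = n" and "n \<ge> 1" "r \<ge> 1"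
  shows "drops (r + 1) n \<sigma> = Suc ` drops r n (\<sigma> \<circ> rot n)"
proof (intro set_eqI iffI)
  fix x
  assume x: "x \<in> drops (r + 1) n \<sigma>"
  then have "x \<noteq> 1" using assms by (auto simp: drops_def)
  then obtain y where "x = Suc y" "y \<ge> 1" using x by (cases x) (auto simp: drops_def)
  then show "x \<in> Suc ` drops r n (\<sigma> \<circ> rot n)" using x by (auto simp: drops_def rot_def)
next
  fix x
  assume "x \<in> Suc ` drops r n (\<sigma> \<circ> rot n)"
  then show "x \<in> drops (r + 1) n \<sigma>"
    using assms by (auto simp: drops_def rot_def split: if_splits)
qed

theorem theorem7:
  fixes n m r :: nat
  assumes "n \<ge> 1" and "m \<ge> 1" and "r \<ge> 1"
  shows "A (r + 1) n m 1 = A r n m n"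
proof -
  let ?P = "{\<sigma>. \<sigma> permutes {1..n}}"
  let ?f = "\<lambda>\<sigma>. \<sigma> \<circ> rot n"
  have rot: "rot n permutes {1..n}" using assms(1) by (rule rot_permutes)
  have top: "(\<sigma> \<circ> rot n) n = \<sigma> 1" for \<sigma> :: "nat \<Rightarrow> nat" by (simp add: rot_def)
  have "A (r + 1) n m 1 = card {\<sigma> \<in> ?P. card (drops (r + 1) n \<sigma>) = m \<and> \<sigma> 1 = n}"
    using assms by (intro A_eq_card_drops) auto
  \<comment> \<open>The condition \<open>\<sigma> 1 = n\<close> licenses \<open>drops_rot\<close>,
    and \<open>Suc\<close> preserves the number of drops.\<close>
  also have "\<dots> = card {\<sigma> \<in> ?P. card (drops r n (?f \<sigma>)) = m \<and> (?f \<sigma>) n = n}"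
    using assms drops_rot[of _ n r]
    by (intro arg_cong[where f = card] Collect_cong) (auto simp: top card_image simp del: o_apply)
  also have "\<dots> = card {\<sigma> \<in> ?P. card (drops r n \<sigma>) = m \<and> \<sigma> n = n}"
  proof (rule card_Collect_comp)
    show "inj_on ?f ?P"
    proof (rule inj_onI)
      fix \<sigma> \<tau> :: "nat \<Rightarrow> nat"
      assume "?f \<sigma> = ?f \<tau>"
      then have "?f \<sigma> \<circ> inv (rot n) = ?f \<tau> \<circ> inv (rot n)" by (rule arg_cong)
      then show "\<sigma> = \<tau>" by (simp only: comp_assoc permutes_inv_o[OF rot] comp_id)
    qed
    show "?f ` ?P \<subseteq> ?P" using rot by (auto intro: permutes_compose)
  qed (simp add: finite_permutations)
  also have "\<dots> = A r n m n"
    using assms by (intro A_eq_card_drops[symmetric]) auto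
  finally show ?thesis .
qed

end
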